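(* Let $n\ge 1$ and let $A,B$ be $n\times n$ matrices with entries in $\{0,\dots,n-1\}$ such that every row of $A$ and every column of $B$ is a permutation of $\{0,\dots,n-1\}$. Then $$\sum_{i,j}\min(A_{ij},B_{ij})\ \ge\ n\left\lfloor\frac{(n-1)^2}{4}\right\rfloor ,$$ and equality holds when $A,B$ are the rank-complement matrices of the cyclic Hollow-Shell profile $C_n$.
   Context: For a stable marriage instance with $n$ men and $n$ women indexed by $0,\dots,n-1$, let $r_M(i,j)\in\{1,\dots,n\}$ be the rank of woman $j$ in man $i$'s list and $r_W(j,i)\in\{1,\dots,n\}$ the rank of man $i$ in woman $j$'s list (1 is best). The rank-complement matrices are $A_{ij}=n-r_M(i,j)$ and $B_{ij}=n-r_W(j,i)$. The cyclic Hollow-Shell $C_n$ is the instance with $r_M(g,h)=((h-g)\bmod n)+1$ and $r_W(h,g)=n-((h-g)\bmod n)$, where $\bmod\ n$ takes values in $\{0,\dots,n-1\}$. *)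

theory Defs
  imports Main
begin

text \<open>
  An instance with \<open>n\<close> men and \<open>n\<close> women, both indexed by \<open>0, ..., n - 1\<close>, is given by its two
  rank functions; arguments outside \<open>{..<n}\<close> are irrelevant.  Matrices are likewise functions
  \<open>nat \<Rightarrow> nat \<Rightarrow> nat\<close> of which only the entries with both indices below \<open>n\<close> matter.
\<close>

definition marriage_instance ::
    "nat \<Rightarrow> (nat \<Rightarrow> nat \<Rightarrow> nat) \<Rightarrow> (nat \<Rightarrow> nat \<Rightarrow> nat) \<Rightarrow> bool" where
  "marriage_instance n r\<^sub>M r\<^sub>W \<longleftrightarrow>
     (\<forall>i<n. bij_betw (\<lambda>j. r\<^sub>M i j) {..<n} {1..n}) \<and>
     (\<forall>j<n. bij_betw (\<lambda>i. r\<^sub>W j i) {..<n} {1..n})"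

text \<open>
  Natural-number subtraction does not truncate below, since ranks are at most \<open>n\<close>.
  Note the swapped arguments in the second matrix: both matrices are indexed by (man, woman).
\<close>

definition men_rank_complement :: "nat \<Rightarrow> (nat \<Rightarrow> nat \<Rightarrow> nat) \<Rightarrow> nat \<Rightarrow> nat \<Rightarrow> nat" where
  "men_rank_complement n r\<^sub>M i j = n - r\<^sub>M i j"

definition women_rank_complement :: "nat \<Rightarrow> (nat \<Rightarrow> nat \<Rightarrow> nat) \<Rightarrow> nat \<Rightarrow> nat \<Rightarrow> nat" where
  "women_rank_complement n r\<^sub>W i j = n - r\<^sub>W j i"

text \<open>
  The difference \<open>h - g\<close> is taken in the integers, so that for \<open>n \<ge> 1\<close> its residue lies in
  \<open>{0..n - 1}\<close> also when \<open>h < g\<close>.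
\<close>

definition hollow_shell_men :: "nat \<Rightarrow> nat \<Rightarrow> nat \<Rightarrow> nat" where
  "hollow_shell_men n g h = nat ((int h - int g) mod int n) + 1"

definition hollow_shell_women :: "nat \<Rightarrow> nat \<Rightarrow> nat \<Rightarrow> nat" where
  "hollow_shell_women n h g = n - nat ((int h - int g) mod int n)"

lemma marriage_instance_hollow_shell:
  "marriage_instance n (hollow_shell_men n) (hollow_shell_women n)"
proof (cases "n = 0")
  case True
  then show ?thesis by (simp add: marriage_instance_def)
next
  case False
  define d where "d g h = nat ((int h - int g) mod int n)" for g h :: nat
  have d_less: "d g h < n" for g h
    using False by (simp add: d_def nat_less_iff)
  have int_d: "int (d g h) = (int h - int g) mod int n" for g h
    using False by (simp add: d_def)
  have dvd: "int n dvd (int h - int g) - (int h' - int g')" if "d g h = d g' h'" for g h g' h'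
    using that int_d by (metis mod_eq_dvd_iff)
  have eq: "x = y" if "x < n" "y < n" "int n dvd int x - int y" for x y
    using that by (metis mod_eq_dvd_iff mod_less of_nat_eq_iff of_nat_mod)
  have inj1: "h = h'" if "h < n" "h' < n" "d g h = d g h'" for g h h'
    using dvd[OF that(3)] eq[of h h'] that by simp
  have inj2: "g = g'" if "g < n" "g' < n" "d g h = d g' h" for g g' h
    using dvd[OF that(3)] eq[of g' g] that by simp
  have bij: "bij_betw f {..<n} {1..n}" if "inj_on f {..<n}" "f ` {..<n} \<subseteq> {1..n}" for f
    using that by (simp add: bij_betw_def card_image card_subset_eq)
  have "bij_betw (hollow_shell_men n g) {..<n} {1..n}" for g
    by (rule bij) (use d_less[of g] inj1[of _ _ g] in
        \<open>auto simp: hollow_shell_men_def d_def[symmetric] Suc_le_eq intro!: inj_onI\<close>)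
  moreover have "bij_betw (hollow_shell_women n h) {..<n} {1..n}" for h
  proof (rule bij)
    show "inj_on (hollow_shell_women n h) {..<n}"
    proof (rule inj_onI)
      fix g g' assume "g \<in> {..<n}" "g' \<in> {..<n}"
        and "hollow_shell_women n h g = hollow_shell_women n h g'"
      then show "g = g'"
        using d_less[of g h] d_less[of g' h] inj2[of g g' h]
        by (simp add: hollow_shell_women_def d_def[symmetric])
    qed
    show "hollow_shell_women n h ` {..<n} \<subseteq> {1..n}"
      using d_less[of _ h] by (auto simp: hollow_shell_women_def d_def[symmetric] Suc_le_eq)
  qed
  ultimately show ?thesis by (simp add: marriage_instance_def)
qed

end

theory Submission
  imports Defs
begin

text \<open>
  For every threshold \<open>m\<close> the pointwise bound \<open>min a m + min b m \<le> min a b + m\<close> holds, with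
  equality when \<open>m\<close> lies between \<open>a\<close> and \<open>b\<close>. Summed over all cells, its left-hand side is the
  same for all admissible pairs of matrices, because every row of \<open>A\<close> and every column of \<open>B\<close>
  contributes \<open>\<Sum>k<n. min k m\<close>. The choice \<open>m = (n - 1) div 2\<close> gives the lower bound, and it is
  attained on the cyclic Hollow-Shell, where \<open>A + B = n - 1\<close> in every cell.
\<close>

text \<open>Induction starts at \<open>n = m\<close>, where every minimum is \<open>k\<close> itself
  and the sum is Gauss's. Each further index contributes \<open>m\<close>, so both sides grow by
  \<open>2 * m\<close>. The additive form avoids subtraction on naturals.\<close>

lemma sum_min_threshold:
  fixes m n :: nat
  assumes "m \<le> n"
  shows "2 * (\<Sum>k<n. min k m) + m * m + m = 2 * n * m"
  using assms
proof (induction n rule: dec_induct)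
  case base
  have "2 * (\<Sum>k<m. k) + m = m * m"
    by (induction m) auto
  then show ?case
    by simp
qed simp

lemma sum_min_half:
  fixes n :: nat
  assumes "n \<ge> 1"
  shows "2 * (\<Sum>k<n. min k ((n - 1) div 2)) = n * ((n - 1) div 2) + (n - 1)\<^sup>2 div 4"
proof -
  define m where "m = (n - 1) div 2"
  \<comment> \<open>The parity of \<open>n\<close> decides the floor: the quarter square is
    \<open>m * m\<close> for odd \<open>n\<close> and \<open>m * m + m\<close> for even
    \<open>n\<close>, where a remainder 1 is dropped.\<close>
  consider "n = 2 * m + 1" | "n = 2 * m + 2"
    using assms unfolding m_def by linarith
  then have "(n - 1)\<^sup>2 div 4 + n * m + m * m + m = 2 * n * m"
  proof cases
    case 1
    then have "(n - 1)\<^sup>2 = 4 * (m * m)"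
      by (simp add: power2_eq_square)
    with 1 show ?thesis
      by (simp add: algebra_simps)
  next
    case 2
    then have "(n - 1)\<^sup>2 = 1 + 4 * (m * m + m)"
      by (simp add: power2_eq_square algebra_simps)
    then have "(n - 1)\<^sup>2 div 4 = m * m + m"
      by simp
    with 2 show ?thesis
      by (simp add: algebra_simps)
  qed
  moreover have "2 * (\<Sum>k<n. min k m) + m * m + m = 2 * n * m"
    by (rule sum_min_threshold) (simp add: m_def)
  ultimately show ?thesis
    unfolding m_def by linarith
qed

lemma sum_rows_cols:
  fixes A B :: "nat \<Rightarrow> nat \<Rightarrow> nat" and f :: "nat \<Rightarrow> nat"
  assumes "\<And>i. i < n \<Longrightarrow> bij_betw (\<lambda>j. A i j) {..<n} {..<n}"
    and "\<And>j. j < n \<Longrightarrow> bij_betw (\<lambda>i. B i j) {..<n} {..<n}"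
  shows "(\<Sum>i<n. \<Sum>j<n. f (A i j) + f (B i j)) = n * (2 * (\<Sum>k<n. f k))"
proof -
  have "(\<Sum>i<n. \<Sum>j<n. f (A i j)) = n * (\<Sum>k<n. f k)"
    using sum.reindex_bij_betw[OF assms(1), of _ f] by simp
  moreover have "(\<Sum>i<n. \<Sum>j<n. f (B i j)) = n * (\<Sum>k<n. f k)"
    \<comment> \<open>\<open>B\<close> is a permutation along columns only, hence the exchange of
      summation order.\<close>
    by (subst sum.swap) (use sum.reindex_bij_betw[OF assms(2), of _ f] in simp)
  ultimately show ?thesis
    by (simp add: sum.distrib)
qed

lemma bij_betw_rank_complement:
  fixes n :: nat
  assumes "bij_betw r {..<n} {1..n}"
  shows "bij_betw (\<lambda>i. n - r i) {..<n} {..<n}"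
proof -
  have "bij_betw (\<lambda>k. n - k) {1..n} {..<n}"
    by (rule bij_betw_byWitness[where f' = "\<lambda>k. n - k"]) auto
  from bij_betw_trans[OF assms this] show ?thesis
    by (simp add: o_def)
qed

text \<open>For \<open>d = (j - i) mod n\<close> the two entries are \<open>n - 1 - d\<close> and
  \<open>d\<close>; since \<open>d < n\<close>, no subtraction truncates.\<close>

lemma hollow_shell_complement_add:
  assumes "n \<ge> 1"
  shows "men_rank_complement n (hollow_shell_men n) i j
    + women_rank_complement n (hollow_shell_women n) i j = n - 1"
proof -
  have "nat ((int j - int i) mod int n) < n"
    using assms by (simp add: nat_less_iff)
  then show ?thesis
    by (simp add: men_rank_complement_def women_rank_complement_def
        hollow_shell_men_def hollow_shell_women_def)
qed

theorem lemma4p1: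
  fixes n :: nat
  assumes "n \<ge> 1"
  shows
    "(\<forall>A B :: nat \<Rightarrow> nat \<Rightarrow> nat.
        (\<forall>i<n. bij_betw (\<lambda>j. A i j) {..<n} {0..n - 1}) \<longrightarrow>
        (\<forall>j<n. bij_betw (\<lambda>i. B i j) {..<n} {0..n - 1}) \<longrightarrow>
        (\<forall>i<n. \<forall>j<n. A i j \<in> {0..n - 1} \<and> B i j \<in> {0..n - 1}) \<longrightarrow>
        (\<Sum>i<n. \<Sum>j<n. min (A i j) (B i j)) \<ge> n * ((n - 1)\<^sup>2 div 4)) \<and>
     (\<Sum>i<n. \<Sum>j<n. min (men_rank_complement n (hollow_shell_men n) i j)
                       (women_rank_complement n (hollow_shell_women n) i j))
       = n * ((n - 1)\<^sup>2 div 4)"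
proof -
  define m where "m = (n - 1) div 2"
  \<comment> \<open>Serves both the bound and the equality case; the sum of the constant
    \<open>m\<close> is left unevaluated so that it cancels later.\<close>
  have total: "(\<Sum>i<n. \<Sum>j<n. min (A i j) m + min (B i j) m)
      = n * ((n - 1)\<^sup>2 div 4) + (\<Sum>i<n. \<Sum>j<n. m)"
    if "\<And>i. i < n \<Longrightarrow> bij_betw (\<lambda>j. A i j) {..<n} {..<n}"
      and "\<And>j. j < n \<Longrightarrow> bij_betw (\<lambda>i. B i j) {..<n} {..<n}"
    for A B :: "nat \<Rightarrow> nat \<Rightarrow> nat"
    using sum_rows_cols[of n A B "\<lambda>k. min k m", OF that] sum_min_half[OF assms]
    unfolding m_def[symmetric] by (simp add: algebra_simps)
  have range: "{0..n - 1} = {..<n}"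
    using assms by auto
  have "n * ((n - 1)\<^sup>2 div 4) \<le> (\<Sum>i<n. \<Sum>j<n. min (A i j) (B i j))"
    if "\<forall>i<n. bij_betw (\<lambda>j. A i j) {..<n} {0..n - 1}"
      and "\<forall>j<n. bij_betw (\<lambda>i. B i j) {..<n} {0..n - 1}"
    for A B :: "nat \<Rightarrow> nat \<Rightarrow> nat"
  proof -
    \<comment> \<open>In each cell, bound the truncation of the smaller entry by that entry and the
      truncation of the other by \<open>m\<close>.\<close>
    have "(\<Sum>i<n. \<Sum>j<n. min (A i j) m + min (B i j) m)
        \<le> (\<Sum>i<n. \<Sum>j<n. min (A i j) (B i j) + m)"
      by (intro sum_mono) linarith
    moreover have "(\<Sum>i<n. \<Sum>j<n. min (A i j) m + min (B i j) m)
        = n * ((n - 1)\<^sup>2 div 4) + (\<Sum>i<n. \<Sum>j<n. m)"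
      using that unfolding range by (intro total) blast+
    moreover have "(\<Sum>i<n. \<Sum>j<n. min (A i j) (B i j) + m)
        = (\<Sum>i<n. \<Sum>j<n. min (A i j) (B i j)) + (\<Sum>i<n. \<Sum>j<n. m)"
      by (simp only: sum.distrib)
    ultimately show ?thesis
      by linarith
  qed
  moreover have "(\<Sum>i<n. \<Sum>j<n. min (men_rank_complement n (hollow_shell_men n) i j)
                       (women_rank_complement n (hollow_shell_women n) i j))
       = n * ((n - 1)\<^sup>2 div 4)"
  proof -
    let ?A = "men_rank_complement n (hollow_shell_men n)"
    let ?B = "women_rank_complement n (hollow_shell_women n)"
    \<comment> \<open>The two entries of a cell add up to \<open>2 * m\<close> or
      \<open>2 * m + 1\<close>, so they can be neither both below \<open>m\<close> nor both above
      it: \<open>m\<close> lies between them.\<close>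
    have "2 * m \<le> n - 1" "n - 1 \<le> 2 * m + 1"
      unfolding m_def by linarith+
    then have "min (?A i j) m + min (?B i j) m = min (?A i j) (?B i j) + m" for i j
      using hollow_shell_complement_add[OF assms, of i j] by (simp only: min_def split: if_split) linarith
    moreover have "(\<Sum>i<n. \<Sum>j<n. min (?A i j) m + min (?B i j) m)
        = n * ((n - 1)\<^sup>2 div 4) + (\<Sum>i<n. \<Sum>j<n. m)"
    proof (rule total)
      show "bij_betw (\<lambda>j. ?A i j) {..<n} {..<n}" if "i < n" for i
        unfolding men_rank_complement_def
        by (rule bij_betw_rank_complement)
          (use that marriage_instance_hollow_shell[of n] in \<open>simp add: marriage_instance_def\<close>)
      show "bij_betw (\<lambda>i. ?B i j) {..<n} {..<n}" if "j < n" for j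
        unfolding women_rank_complement_def
        by (rule bij_betw_rank_complement)
          (use that marriage_instance_hollow_shell[of n] in \<open>simp add: marriage_instance_def\<close>)
    qed
    ultimately have "(\<Sum>i<n. \<Sum>j<n. min (?A i j) (?B i j) + m)
        = n * ((n - 1)\<^sup>2 div 4) + (\<Sum>i<n. \<Sum>j<n. m)"
      by (simp only:)
    then show ?thesis
      by (simp add: sum.distrib)
  qed
  ultimately show ?thesis
    by blast
qed

end
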